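(* Let $(\Omega,\mathcal{H},\mathbb{E})$ be a sublinear expectation space with conjugate expectation $\mathcal{E}[X]:=-\mathbb{E}[-X]$ and associated capacities $\mathbb{V}(A):=\mathbb{E}[I_A]$, $v(A):=\mathcal{E}[I_A]$ ($A\in\mathcal{F}$), where $\mathbb{V}$ is upper continuous. Let $\{X_i\}_{i=1}^\infty$ be a sequence in $\mathcal{H}$ satisfying: (i) $X_{i+1}$ is independent of $(X_1,\dots,X_i)$ under $\mathbb{E}$ for each $i=1,2,\dots$; (ii) $\mathbb{E}[X_i]=\overline{\mu}_i$ and $\mathcal{E}[X_i]=\underline{\mu}_i$, where $-\infty<\underline{\mu}_i\le\overline{\mu}_i<\infty$, for each $i\ge 1$; (iii) there are two constants $\overline{\mu}$ and $\underline{\mu}$ such that $$\lim_{n\to\infty}\frac1n\sum_{i=1}^n|\underline{\mu}_i-\underline{\mu}|=0,\qquad \lim_{n\to\infty}\frac1n\sum_{i=1}^n|\overline{\mu}_i-\overline{\mu}|=0;$$ (iv) $\sup_{i\ge1}\mathbb{E}[|X_i|^2]<\infty$. Then for every $\varepsilon>0$, $$\lim_{n\to\infty}v\left(\frac1n\sum_{i=1}^nX_i\in(\underline{\mu}-\varepsilon,\overline{\mu}+\varepsilon)\right)=1.$$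
   Context: Sublinear expectation space: $\Omega$ is a set and $\mathcal{H}$ is a linear space of real-valued functions on $\Omega$ (the "random variables") containing all constants and such that $X\in\mathcal{H}$ implies $|X|\in\mathcal{H}$. A sublinear expectation is a functional $\mathbb{E}:\mathcal{H}\to\mathbb{R}$ such that for all $X,Y\in\mathcal{H}$: (a) $X\ge Y$ implies $\mathbb{E}[X]\ge\mathbb{E}[Y]$; (b) $\mathbb{E}[c]=c$ for every constant $c$; (c) $\mathbb{E}[X]-\mathbb{E}[Y]\le\mathbb{E}[X-Y]$; (d) $\mathbb{E}[\lambda X]=\lambda\mathbb{E}[X]$ for all $\lambda\ge0$. The triple $(\Omega,\mathcal{H},\mathbb{E})$ is then called a sublinear expectation space. Conjugate expectation: $\mathcal{E}[X]:=-\mathbb{E}[-X]$ for $X\in\mathcal{H}$. Capacities and standing assumption: $\mathcal{F}$ is a $\sigma$-algebra on $\Omega$, and for $A\in\mathcal{F}$, $\mathbb{V}(A):=\mathbb{E}[I_A]$ and $v(A):=\mathcal{E}[I_A]$ ($I_A$ the indicator function), so that $\mathbb{V}(A)+v(A^c)=1$. It is assumed throughout that $\mathbb{V}$ is an upper continuous capacity: $\mathbb{V}(\emptyset)=0$, $\mathbb{V}(\Omega)=1$; $\mathbb{V}(A)\le\mathbb{V}(B)$ whenever $A\subset B$, $A,B\in\mathcal{F}$; and $\mathbb{V}(A_n)\downarrow\mathbb{V}(A)$ whenever $A_n\downarrow A$ with $A_n,A\in\mathcal{F}$. Independence: for $Y_1,\dots,Y_n\in\mathcal{H}$, $Y_n$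 is independent of $X:=(Y_1,\dots,Y_{n-1})$ under $\mathbb{E}$ if for each measurable function $\varphi$ on $\mathbb{R}^n$ with $\varphi(X,Y_n)\in\mathcal{H}$ and $\varphi(x,Y_n)\in\mathcal{H}$ for each $x\in\mathbb{R}^{n-1}$, one has $\mathbb{E}[\varphi(X,Y_n)]=\mathbb{E}[\overline{\varphi}(X)]$, where $\overline{\varphi}(x):=\mathbb{E}[\varphi(x,Y_n)]$ and $\overline{\varphi}(X)\in\mathcal{H}$. Convention: the $X_i$ are $\mathcal{F}$-measurable, and $\mathcal{H}$ is understood to be rich enough to contain every function to which $\mathbb{E}$ is applied (indicators $I_A$ with $A\in\mathcal{F}$, the variables $|X_i|^2$, and continuous linear-growth or bounded Lipschitz functions of finitely many of the $X_i$). *)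

theory Defs
  imports "HOL-Analysis.Analysis"
begin

text \<open>The set \<open>\<Omega>\<close> is the universe of the type \<open>'a\<close>. An expectation is a total function of type
  \<open>('a \<Rightarrow> real) \<Rightarrow> real\<close>, but it is only constrained on the space \<open>H\<close> of random variables.\<close>

locale sublinear_expectation_space =
  fixes H :: "('a \<Rightarrow> real) set" and E :: "('a \<Rightarrow> real) \<Rightarrow> real"
  assumes const_mem: "\<And>c. (\<lambda>\<omega>. c) \<in> H"
    and add_mem: "\<And>X Y. X \<in> H \<Longrightarrow> Y \<in> H \<Longrightarrow> (\<lambda>\<omega>. X \<omega> + Y \<omega>) \<in> H"
    and scale_mem: "\<And>c X. X \<in> H \<Longrightarrow> (\<lambda>\<omega>. c * X \<omega>) \<in> H"
    and abs_mem: "\<And>X. X \<in> H \<Longrightarrow> (\<lambda>\<omega>. \<bar>X \<omega>\<bar>) \<in> H"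
    and monotone: "\<And>X Y. X \<in> H \<Longrightarrow> Y \<in> H \<Longrightarrow> (\<And>\<omega>. Y \<omega> \<le> X \<omega>) \<Longrightarrow> E Y \<le> E X"
    and const: "\<And>c. E (\<lambda>\<omega>. c) = c"
    and subadditive: "\<And>X Y. X \<in> H \<Longrightarrow> Y \<in> H \<Longrightarrow> E X - E Y \<le> E (\<lambda>\<omega>. X \<omega> - Y \<omega>)"
    and pos_homogeneous: "\<And>c X. X \<in> H \<Longrightarrow> 0 \<le> c \<Longrightarrow> E (\<lambda>\<omega>. c * X \<omega>) = c * E X"

definition conjugate_expectation :: "(('a \<Rightarrow> real) \<Rightarrow> real) \<Rightarrow> ('a \<Rightarrow> real) \<Rightarrow> real" where
  "conjugate_expectation E X = - E (\<lambda>\<omega>. - X \<omega>)"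

definition upper_capacity :: "(('a \<Rightarrow> real) \<Rightarrow> real) \<Rightarrow> 'a set \<Rightarrow> real" where
  "upper_capacity E A = E (indicator A)"

definition lower_capacity :: "(('a \<Rightarrow> real) \<Rightarrow> real) \<Rightarrow> 'a set \<Rightarrow> real" where
  "lower_capacity E A = conjugate_expectation E (indicator A)"

definition upper_continuous_capacity :: "'a set set \<Rightarrow> ('a set \<Rightarrow> real) \<Rightarrow> bool" where
  "upper_continuous_capacity F V \<longleftrightarrow>
     V {} = 0 \<and> V UNIV = 1 \<and>
     (\<forall>A\<in>F. \<forall>B\<in>F. A \<subseteq> B \<longrightarrow> V A \<le> V B) \<and>
     (\<forall>A :: nat \<Rightarrow> 'a set. range A \<subseteq> F \<longrightarrow> decseq A \<longrightarrow>
        (\<lambda>n. V (A n)) \<longlonglongrightarrow> V (\<Inter>n. A n))"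

text \<open>Independence of \<open>Y\<close> from the finite family \<open>(X j)\<close>, \<open>j \<in> J\<close>. A point of \<open>\<real>\<^sup>J\<close> is an
  extensional function on \<open>J\<close>, and a test function on \<open>\<real>\<^sup>J \<times> \<real>\<close> is Borel measurable. Membership of
  \<open>\<lambda>\<omega>. \<phi>\<^sub>b\<^sub>a\<^sub>r (X \<omega>)\<close> in \<open>H\<close>, with \<open>\<phi>\<^sub>b\<^sub>a\<^sub>r x = E (\<lambda>\<omega>. \<phi> x (Y \<omega>))\<close>, is part of what independence
  asserts.\<close>

definition independent_of ::
    "('a \<Rightarrow> real) set \<Rightarrow> (('a \<Rightarrow> real) \<Rightarrow> real) \<Rightarrow> 'i set \<Rightarrow> ('i \<Rightarrow> 'a \<Rightarrow> real) \<Rightarrow> ('a \<Rightarrow> real) \<Rightarrow> bool" where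
  "independent_of H E J X Y \<longleftrightarrow>
     (\<forall>\<phi> :: ('i \<Rightarrow> real) \<Rightarrow> real \<Rightarrow> real.
        (\<lambda>(x, y). \<phi> x y) \<in> borel_measurable ((\<Pi>\<^sub>M j\<in>J. borel) \<Otimes>\<^sub>M borel) \<longrightarrow>
        (\<lambda>\<omega>. \<phi> (\<lambda>j\<in>J. X j \<omega>) (Y \<omega>)) \<in> H \<longrightarrow>
        (\<forall>x \<in> (\<Pi>\<^sub>E j\<in>J. UNIV). (\<lambda>\<omega>. \<phi> x (Y \<omega>)) \<in> H) \<longrightarrow>
        (let \<phi>bar = (\<lambda>x. E (\<lambda>\<omega>. \<phi> x (Y \<omega>))) in
           (\<lambda>\<omega>. \<phi>bar (\<lambda>j\<in>J. X j \<omega>)) \<in> H \<and>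
           E (\<lambda>\<omega>. \<phi> (\<lambda>j\<in>J. X j \<omega>) (Y \<omega>)) = E (\<lambda>\<omega>. \<phi>bar (\<lambda>j\<in>J. X j \<omega>))))"

text \<open>The convention that \<open>H\<close> is rich enough for the sequence \<open>X 1, X 2, \<dots>\<close>. Continuity on
  \<open>\<real>\<^sup>J\<close> is with respect to the product topology; bounded Lipschitz functions on \<open>\<real>\<^sup>J\<close> are continuous
  of linear growth, so the last clause covers them as well.\<close>

definition rich_for ::
    "('a \<Rightarrow> real) set \<Rightarrow> 'a set set \<Rightarrow> (nat \<Rightarrow> 'a \<Rightarrow> real) \<Rightarrow> bool" where
  "rich_for H F X \<longleftrightarrow>
     (\<forall>A\<in>F. indicator A \<in> H) \<and>
     (\<forall>i\<ge>1. (\<lambda>\<omega>. \<bar>X i \<omega>\<bar>\<^sup>2) \<in> H) \<and>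
     (\<forall>J f C. finite J \<longrightarrow> J \<subseteq> {1..} \<longrightarrow>
        continuous_on (\<Pi>\<^sub>E j\<in>J. UNIV) f \<longrightarrow>
        (\<forall>x \<in> (\<Pi>\<^sub>E j\<in>J. UNIV). \<bar>f x\<bar> \<le> C * (1 + (\<Sum>j\<in>J. \<bar>x j\<bar>))) \<longrightarrow>
        (\<lambda>\<omega>. f (\<lambda>j\<in>J. X j \<omega>)) \<in> H)"

end

theory Submission imports Defs begin

text \<open>
  Let \<open>\<psi>\<close> be the one-sided Huber function, which vanishes on the negative axis, is quadratic on
  \<open>[0, 1]\<close> and affine beyond; its derivative is the projection \<open>c\<close> onto \<open>[0, 1]\<close>. It satisfies
  \<open>\<psi> (x + h) \<le> \<psi> x + c x * h + h\<^sup>2 / 2\<close>. Let \<open>T k\<close> be the sum of the first \<open>k\<close> variables, each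
  centred at its upper expectation, divided by \<open>n\<close>. Independence and \<open>c \<ge> 0\<close> make the first-order
  term of \<open>E (\<psi> (T (k + 1)))\<close> vanish, so each of the \<open>n\<close> steps costs at most a constant over
  \<open>n\<^sup>2\<close> and \<open>E (\<psi> (T n)) = O(1 / n)\<close>. Markov's inequality for \<open>\<psi>\<close>, applied to \<open>X\<close> and to \<open>- X\<close>,
  bounds the upper capacity of both tails. Only functions of linear growth of the \<open>X i\<close> and the
  squares of single variables occur, so the variables needed all lie in \<open>H\<close>.
\<close>

section \<open>Real analysis: the one-sided Huber function and centred partial sums\<close>

definition unit_clamp :: "real \<Rightarrow> real" where
  "unit_clamp x = max 0 (min 1 x)"

text \<open>The value is the maximum over \<open>c\<close> in [0, 1] of
  \<open>c * x - c^2 / 2\<close>, attained at the projection of \<open>x\<close>. In this form the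
  second-order bound is algebra in \<open>x\<close> and two clamps.\<close>

definition pos_huber :: "real \<Rightarrow> real" where
  "pos_huber x = unit_clamp x * x - (unit_clamp x)\<^sup>2 / 2"

lemma unit_clamp_bounds: "0 \<le> unit_clamp x" "unit_clamp x \<le> 1"
  by (auto simp: unit_clamp_def)

lemma unit_clamp_0 [simp]: "unit_clamp 0 = 0"
  by (simp add: unit_clamp_def)

lemma pos_huber_0 [simp]: "pos_huber 0 = 0"
  by (simp add: pos_huber_def)

lemma continuous_on_unit_clamp [continuous_intros]:
  "continuous_on S f \<Longrightarrow> continuous_on S (\<lambda>x. unit_clamp (f x))"
  unfolding unit_clamp_def by (intro continuous_intros)

lemma continuous_on_pos_huber [continuous_intros]:
  "continuous_on S f \<Longrightarrow> continuous_on S (\<lambda>x. pos_huber (f x))"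
  unfolding pos_huber_def by (intro continuous_intros) auto

lemma borel_measurable_unit_clamp [measurable]: "unit_clamp \<in> borel_measurable borel"
  unfolding unit_clamp_def by measurable

lemma pos_huber_cases:
  "pos_huber x = (if x \<le> 0 then 0 else if x \<le> 1 then x\<^sup>2 / 2 else x - 1 / 2)"
  by (auto simp: pos_huber_def unit_clamp_def power2_eq_square)

lemma pos_huber_nonneg: "0 \<le> pos_huber x"
  by (auto simp: pos_huber_cases)

lemma pos_huber_pos: "0 < x \<Longrightarrow> 0 < pos_huber x"
  by (auto simp: pos_huber_cases)

lemma pos_huber_mono:
  assumes "x \<le> y" shows "pos_huber x \<le> pos_huber y"
proof -
  have "x\<^sup>2 \<le> y\<^sup>2" if "0 < x"
    using that assms by (intro power_mono) auto
  moreover have "x\<^sup>2 \<le> 1" if "0 < x" "x \<le> 1"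
    using that by (simp add: power_le_one)
  ultimately show ?thesis
    using assms by (auto simp: pos_huber_cases)
qed

text \<open>Linear growth is what puts this function of a partial sum into \<open>H\<close>;
  richness does not guarantee the square of a partial sum there.\<close>

lemma abs_pos_huber_le: "\<bar>pos_huber x\<bar> \<le> \<bar>x\<bar>"
proof -
  have "x\<^sup>2 \<le> x" if "0 < x" "x \<le> 1"
    using that by (simp add: power2_eq_square mult_left_le)
  then show ?thesis
    by (auto simp: pos_huber_cases)
qed

text \<open>With \<open>c\<close> and \<open>d\<close> the clamps at \<open>x\<close> and
  \<open>x + h\<close>, the right side minus the left equals
  \<open>(d - c - h)^2 / 2 - (d - c) * (x - c)\<close>, which is nonnegative.\<close>

lemma pos_huber_add_le: "pos_huber (x + h) \<le> pos_huber x + unit_clamp x * h + h\<^sup>2 / 2"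
proof -
  define c d where "c = unit_clamp x" and "d = unit_clamp (x + h)"
  \<comment> \<open>This is the variational inequality for the projection \<open>c\<close> of
    \<open>x\<close> onto [0, 1], tested at the point \<open>d\<close> of that interval.\<close>
  have "(d - c) * (x - c) \<le> 0"
  proof -
    consider "x \<le> 0" "c = 0" | "c = x" | "1 \<le> x" "c = 1"
      unfolding c_def unit_clamp_def by linarith
    then show ?thesis
      using unit_clamp_bounds[of "x + h"]
      by cases (auto simp: d_def mult_nonneg_nonpos mult_nonpos_nonneg)
  qed
  moreover have "0 \<le> (d - c - h)\<^sup>2"
    by simp
  ultimately show ?thesis
    unfolding pos_huber_def c_def[symmetric] d_def[symmetric]
    by (simp add: power2_eq_square algebra_simps)
qed

text \<open>The sign \<open>s\<close> is 1 or -1, so that one argument serves both tails. The factor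
  \<open>t\<close> is independent of \<open>k\<close>: it stays at 1/n while the sum grows. The
  argument is a point of the sequence space, so that the sum can enter test functions for
  independence.\<close>

definition centred_sum :: "real \<Rightarrow> (nat \<Rightarrow> real) \<Rightarrow> real \<Rightarrow> nat \<Rightarrow> (nat \<Rightarrow> real) \<Rightarrow> real" where
  "centred_sum t a s k x = t * (\<Sum>i=1..k. s * x i - a i)"

lemma centred_sum_cong:
  "(\<And>i. i \<in> {1..k} \<Longrightarrow> x i = y i) \<Longrightarrow> centred_sum t a s k x = centred_sum t a s k y"
  by (simp add: centred_sum_def)

lemma continuous_on_centred_sum [continuous_intros]:
  "continuous_on S (centred_sum t a s k)"
proof -
  have "continuous_on S (\<lambda>x :: nat \<Rightarrow> real. x i)" for i
    by (rule continuous_on_subset[OF continuous_on_product_coordinates]) simp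
  then show ?thesis
    unfolding centred_sum_def by (intro continuous_intros)
qed

lemma abs_centred_sum_le:
  assumes "\<bar>s\<bar> = 1"
  shows "\<bar>centred_sum t a s k x\<bar> \<le> (\<bar>t\<bar> * (1 + (\<Sum>i=1..k. \<bar>a i\<bar>))) * (1 + (\<Sum>i=1..k. \<bar>x i\<bar>))"
proof -
  have "\<bar>s * x i - a i\<bar> \<le> \<bar>x i\<bar> + \<bar>a i\<bar>" for i
    using abs_triangle_ineq4[of "s * x i" "a i"] assms by (simp add: abs_mult)
  then have "\<bar>\<Sum>i=1..k. s * x i - a i\<bar> \<le> (\<Sum>i=1..k. \<bar>x i\<bar> + \<bar>a i\<bar>)"
    by (intro order_trans[OF sum_abs] sum_mono)
  also have "\<dots> = (\<Sum>i=1..k. \<bar>x i\<bar>) + (\<Sum>i=1..k. \<bar>a i\<bar>)"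
    by (rule sum.distrib)
  also have "\<dots> \<le> (1 + (\<Sum>i=1..k. \<bar>a i\<bar>)) * (1 + (\<Sum>i=1..k. \<bar>x i\<bar>))"
    by (simp add: algebra_simps sum_nonneg)
  finally have "\<bar>t\<bar> * \<bar>\<Sum>i=1..k. s * x i - a i\<bar> \<le>
      \<bar>t\<bar> * ((1 + (\<Sum>i=1..k. \<bar>a i\<bar>)) * (1 + (\<Sum>i=1..k. \<bar>x i\<bar>)))"
    by (rule mult_left_mono) simp
  then show ?thesis
    by (simp add: centred_sum_def abs_mult mult.assoc)
qed

section \<open>Calculus of sublinear expectations and membership in \<open>H\<close>\<close>

context sublinear_expectation_space
begin

lemma uminus_mem: "X \<in> H \<Longrightarrow> (\<lambda>\<omega>. - X \<omega>) \<in> H"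
  using scale_mem[of X "-1"] by simp

lemma diff_mem: "X \<in> H \<Longrightarrow> Y \<in> H \<Longrightarrow> (\<lambda>\<omega>. X \<omega> - Y \<omega>) \<in> H"
  using add_mem[of X "\<lambda>\<omega>. - Y \<omega>"] uminus_mem[of Y] by simp

lemma E_add_le:
  assumes "X \<in> H" "Y \<in> H" shows "E (\<lambda>\<omega>. X \<omega> + Y \<omega>) \<le> E X + E Y"
  using subadditive[OF add_mem[OF assms] assms(2)] by simp

lemma E_add_const:
  assumes "X \<in> H" shows "E (\<lambda>\<omega>. X \<omega> + c) = E X + c"
proof (rule antisym)
  show "E (\<lambda>\<omega>. X \<omega> + c) \<le> E X + c"
    using E_add_le[OF assms const_mem[of c]] by (simp add: const)
  show "E X + c \<le> E (\<lambda>\<omega>. X \<omega> + c)"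
    using E_add_le[OF add_mem[OF assms const_mem[of c]] const_mem[of "- c"]] by (simp add: const)
qed

lemma abs_E_le:
  assumes "X \<in> H" "Y \<in> H" "\<And>\<omega>. \<bar>X \<omega>\<bar> \<le> Y \<omega>" shows "\<bar>E X\<bar> \<le> E Y"
proof -
  have "X \<omega> \<le> Y \<omega> \<and> - X \<omega> \<le> Y \<omega>" for \<omega>
    using assms(3)[of \<omega>] by linarith
  then have "E X \<le> E Y" "E (\<lambda>\<omega>. - X \<omega>) \<le> E Y"
    using assms uminus_mem by (auto intro!: monotone)
  \<comment> \<open>Since \<open>- E X\<close> is at most the expectation of \<open>- X\<close>,
    bounding both expectations by \<open>E Y\<close> bounds the absolute value.\<close>
  moreover have "0 \<le> E X + E (\<lambda>\<omega>. - X \<omega>)"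
    using E_add_le[OF assms(1) uminus_mem[OF assms(1)]] by (simp add: const)
  ultimately show ?thesis
    by linarith
qed

text \<open>The bound depends on \<open>K\<close> alone, hence is uniform along the sequence. It
  combines \<open>(x - m)^2 \<le> 2 x^2 + 2 m^2\<close> with
  \<open>\<bar>m\<bar> \<le> K + 1\<close> for \<open>m = E X\<close>; the latter follows from
  \<open>\<bar>x\<bar> \<le> x^2 + 1\<close>.\<close>

lemma E_centred_square_le:
  assumes "X \<in> H" "(\<lambda>\<omega>. (X \<omega>)\<^sup>2) \<in> H"
    and K: "E (\<lambda>\<omega>. (X \<omega>)\<^sup>2) \<le> K"
  shows "(\<lambda>\<omega>. (X \<omega> - E X)\<^sup>2) \<in> H"
    and "E (\<lambda>\<omega>. (X \<omega> - E X)\<^sup>2) \<le> 2 * K + 2 * (K + 1)\<^sup>2"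
proof -
  \<comment> \<open>\<open>H\<close> is not assumed closed under products, so the square is expanded
    into a linear combination of known members.\<close>
  have "(\<lambda>\<omega>. (X \<omega>)\<^sup>2 + (- 2 * E X) * X \<omega> + (E X)\<^sup>2) \<in> H"
    by (intro add_mem scale_mem const_mem assms)
  then show mem: "(\<lambda>\<omega>. (X \<omega> - E X)\<^sup>2) \<in> H"
    by (simp add: power2_eq_square algebra_simps)
  have "\<bar>E X\<bar> \<le> E (\<lambda>\<omega>. (X \<omega>)\<^sup>2 + 1)"
  proof (rule abs_E_le)
    fix \<omega>
    have "0 \<le> (\<bar>X \<omega>\<bar> - 1)\<^sup>2" by simp
    then show "\<bar>X \<omega>\<bar> \<le> (X \<omega>)\<^sup>2 + 1"
      by (simp add: power2_diff)
  qed (intro assms add_mem const_mem)+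
  also have "\<dots> \<le> K + 1"
    using E_add_const[OF assms(2)] K by simp
  finally have "(E X)\<^sup>2 \<le> (K + 1)\<^sup>2"
    by (auto intro: power2_le_iff_abs_le[THEN iffD2])
  moreover have "E (\<lambda>\<omega>. (X \<omega> - E X)\<^sup>2) \<le> E (\<lambda>\<omega>. 2 * (X \<omega>)\<^sup>2 + 2 * (E X)\<^sup>2)"
  proof (rule monotone)
    fix \<omega>
    have "0 \<le> (X \<omega> + E X)\<^sup>2" by simp
    then show "(X \<omega> - E X)\<^sup>2 \<le> 2 * (X \<omega>)\<^sup>2 + 2 * (E X)\<^sup>2"
      by (simp add: power2_eq_square algebra_simps)
  qed (intro mem assms add_mem scale_mem const_mem)+
  moreover have "E (\<lambda>\<omega>. 2 * (X \<omega>)\<^sup>2 + 2 * (E X)\<^sup>2) = 2 * E (\<lambda>\<omega>. (X \<omega>)\<^sup>2) + 2 * (E X)\<^sup>2"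
    using E_add_const[OF scale_mem[OF assms(2)]] pos_homogeneous[OF assms(2)] by simp
  ultimately show "E (\<lambda>\<omega>. (X \<omega> - E X)\<^sup>2) \<le> 2 * K + 2 * (K + 1)\<^sup>2"
    using K by linarith
qed

text \<open>Richness speaks of extensional tuples over a finite index set. A function that reads
  only the first \<open>k\<close> coordinates takes the same value on the whole sequence, which
  spares later arguments the restriction.\<close>

lemma rich_for_mem:
  assumes "rich_for H F X" "continuous_on UNIV f"
    and "\<And>x. \<bar>f x\<bar> \<le> C * (1 + (\<Sum>i=1..k. \<bar>x i\<bar>))"
    and "\<And>x y. (\<And>i. i \<in> {1..k} \<Longrightarrow> x i = y i) \<Longrightarrow> f x = f y"
  shows "(\<lambda>\<omega>. f (\<lambda>i. X i \<omega>)) \<in> H"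
proof -
  have "(\<lambda>\<omega>. f (\<lambda>j\<in>{1..k}. X j \<omega>)) \<in> H"
  proof -
    have "(\<lambda>\<omega>. g (\<lambda>j\<in>J. X j \<omega>)) \<in> H"
      if "finite J" "J \<subseteq> {1..}" "continuous_on (\<Pi>\<^sub>E j\<in>J. UNIV) g"
        "\<forall>x \<in> (\<Pi>\<^sub>E j\<in>J. UNIV). \<bar>g x\<bar> \<le> C * (1 + (\<Sum>j\<in>J. \<bar>x j\<bar>))" for J g
      using assms(1) that unfolding rich_for_def by blast
    from this[OF _ _ continuous_on_subset[OF assms(2) subset_UNIV]] show ?thesis
      using assms(3) by auto
  qed
  moreover have "f (\<lambda>j\<in>{1..k}. X j \<omega>) = f (\<lambda>i. X i \<omega>)" for \<omega>
    by (rule assms(4)) simp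
  ultimately show ?thesis
    by simp
qed

lemma pos_huber_centred_sum_mem:
  assumes "rich_for H F X" "\<bar>s\<bar> = 1"
  shows "(\<lambda>\<omega>. pos_huber (centred_sum t a s k (\<lambda>i. X i \<omega>))) \<in> H"
proof (rule rich_for_mem[OF assms(1)])
  show "continuous_on UNIV (\<lambda>x. pos_huber (centred_sum t a s k x))"
    by (intro continuous_intros)
  show "\<bar>pos_huber (centred_sum t a s k x)\<bar> \<le>
      (\<bar>t\<bar> * (1 + (\<Sum>i=1..k. \<bar>a i\<bar>))) * (1 + (\<Sum>i=1..k. \<bar>x i\<bar>))" for x
    using abs_pos_huber_le abs_centred_sum_le[OF assms(2)] by (rule order_trans)
  show "pos_huber (centred_sum t a s k x) = pos_huber (centred_sum t a s k y)"
    if "\<And>i. i \<in> {1..k} \<Longrightarrow> x i = y i" for x y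
    by (simp only: centred_sum_cong[of k x y, OF that])
qed

text \<open>The clamp is bounded by 1, so the product with a single centred variable still grows
  linearly. An unbounded derivative, such as that of the square, would give quadratic
  growth.\<close>

lemma clamp_centred_sum_times_mem:
  assumes "rich_for H F X" "\<bar>s\<bar> = 1"
  shows "(\<lambda>\<omega>. unit_clamp (centred_sum t a s k (\<lambda>i. X i \<omega>)) * (s * X (k + 1) \<omega> - a (k + 1))) \<in> H"
proof (rule rich_for_mem[OF assms(1), where k = "k + 1"
      and f = "\<lambda>x. unit_clamp (centred_sum t a s k x) * (s * x (k + 1) - a (k + 1))"])
  show "continuous_on UNIV (\<lambda>x. unit_clamp (centred_sum t a s k x) * (s * x (k + 1) - a (k + 1)))"
    by (intro continuous_intros continuous_on_product_coordinates)
  fix x :: "nat \<Rightarrow> real"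
  have "\<bar>s * x (k + 1) - a (k + 1)\<bar> \<le> \<bar>x (k + 1)\<bar> + \<bar>a (k + 1)\<bar>"
    using abs_triangle_ineq4[of "s * x (k + 1)" "a (k + 1)"] assms(2) by (simp add: abs_mult)
  moreover have "\<bar>x (k + 1)\<bar> \<le> (\<Sum>i=1..k+1. \<bar>x i\<bar>)"
    by (rule member_le_sum) auto
  moreover have "\<bar>unit_clamp u * v\<bar> \<le> \<bar>v\<bar>" for u v
    using unit_clamp_bounds[of u] by (simp add: abs_mult mult_left_le_one_le)
  ultimately have "\<bar>unit_clamp (centred_sum t a s k x) * (s * x (k + 1) - a (k + 1))\<bar>
      \<le> (\<Sum>i=1..k+1. \<bar>x i\<bar>) + \<bar>a (k + 1)\<bar>"
    by (meson add_right_mono order_trans)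
  also have "\<dots> \<le> (1 + \<bar>a (k + 1)\<bar>) * (1 + (\<Sum>i=1..k+1. \<bar>x i\<bar>))"
    using mult_nonneg_nonneg[of "\<bar>a (k + 1)\<bar>" "\<Sum>i=1..k+1. \<bar>x i\<bar>"]
    by (simp only: distrib_left distrib_right) (simp add: sum_nonneg)
  finally show "\<bar>unit_clamp (centred_sum t a s k x) * (s * x (k + 1) - a (k + 1))\<bar>
      \<le> (1 + \<bar>a (k + 1)\<bar>) * (1 + (\<Sum>i=1..k+1. \<bar>x i\<bar>))" .
next
  fix x y :: "nat \<Rightarrow> real"
  assume eq: "\<And>i. i \<in> {1..k+1} \<Longrightarrow> x i = y i"
  then have "centred_sum t a s k x = centred_sum t a s k y"
    by (intro centred_sum_cong) auto
  then show "unit_clamp (centred_sum t a s k x) * (s * x (k + 1) - a (k + 1)) =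
      unit_clamp (centred_sum t a s k y) * (s * y (k + 1) - a (k + 1))"
    using eq by simp
qed

section \<open>Independence and the bound on the expected Huber function\<close>

lemma E_clamp_centred_sum_times:
  assumes "rich_for H F X" "\<bar>s\<bar> = 1" "X (k + 1) \<in> H"
    and indep: "1 \<le> k \<Longrightarrow> independent_of H E {1..k} X (X (k + 1))"
    and a: "E (\<lambda>\<omega>. s * X (k + 1) \<omega>) = a (k + 1)"
  shows "E (\<lambda>\<omega>. unit_clamp (centred_sum t a s k (\<lambda>i. X i \<omega>)) * (s * X (k + 1) \<omega> - a (k + 1))) = 0"
proof (cases "k = 0")
  case True
  then show ?thesis
    by (simp add: centred_sum_def const)
next
  case False
  define \<phi> where "\<phi> = (\<lambda>x y. unit_clamp (centred_sum t a s k x) * (s * y - a (k + 1)))"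
  \<comment> \<open>Independence evaluates \<open>\<phi>\<close> at the tuple restricted to {1..k},
    and \<open>\<phi>\<close> reads no other coordinates.\<close>
  have \<phi>_X: "\<phi> (\<lambda>j\<in>{1..k}. X j \<omega>) y = \<phi> (\<lambda>i. X i \<omega>) y" for \<omega> y
    unfolding \<phi>_def by (subst centred_sum_cong[of k _ "\<lambda>i. X i \<omega>"]) auto
  have "(\<lambda>x. centred_sum t a s k (fst x)) \<in> borel_measurable ((\<Pi>\<^sub>M j\<in>{1..k}. borel) \<Otimes>\<^sub>M (borel :: real measure))"
    unfolding centred_sum_def by measurable
  then have meas: "(\<lambda>(x, y). \<phi> x y) \<in> borel_measurable ((\<Pi>\<^sub>M j\<in>{1..k}. borel) \<Otimes>\<^sub>M borel)"
    unfolding \<phi>_def case_prod_beta by measurable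
  have lin_mem: "(\<lambda>\<omega>. s * X (k + 1) \<omega> - a (k + 1)) \<in> H"
    by (intro diff_mem scale_mem const_mem assms)
  then have slice_mem: "(\<lambda>\<omega>. \<phi> x (X (k + 1) \<omega>)) \<in> H" for x
    unfolding \<phi>_def by (rule scale_mem)
  have "E (\<lambda>\<omega>. s * X (k + 1) \<omega> - a (k + 1)) = 0"
    using E_add_const[OF scale_mem[OF assms(3)], of s "- a (k + 1)"] a by simp
  \<comment> \<open>With the past frozen at \<open>x\<close>, the clamp is a nonnegative constant,
    and positive homogeneity takes it out of \<open>E\<close>. A negative factor could not be taken
    out of a sublinear expectation in this way.\<close>
  then have bar: "E (\<lambda>\<omega>. \<phi> x (X (k + 1) \<omega>)) = 0" for x
    unfolding \<phi>_def by (subst pos_homogeneous[OF lin_mem unit_clamp_bounds(1)]) simp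
  have "(\<lambda>\<omega>. \<phi> (\<lambda>j\<in>{1..k}. X j \<omega>) (X (k + 1) \<omega>)) \<in> H"
    unfolding \<phi>_X unfolding \<phi>_def by (rule clamp_centred_sum_times_mem[OF assms(1,2)])
  moreover have "independent_of H E {1..k} X (X (k + 1))"
    using indep False by simp
  ultimately have "E (\<lambda>\<omega>. \<phi> (\<lambda>j\<in>{1..k}. X j \<omega>) (X (k + 1) \<omega>)) =
      E (\<lambda>\<omega>. E (\<lambda>\<omega>'. \<phi> (\<lambda>j\<in>{1..k}. X j \<omega>) (X (k + 1) \<omega>')))"
    using meas slice_mem unfolding independent_of_def Let_def by blast
  then show ?thesis
    unfolding bar const \<phi>_X by (simp only: \<phi>_def)
qed

text \<open>Induction on \<open>k\<close> with \<open>t\<close> fixed: the new variable adds the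
  increment \<open>t * Y\<close>, whose first-order term has expectation 0 and whose quadratic term
  costs half of \<open>t^2\<close> times the bound on the centred second moment. For
  \<open>t = 1/n\<close> and \<open>k = n\<close> the total is of order 1/n.\<close>

lemma E_pos_huber_centred_sum_le:
  assumes rich: "rich_for H F X" and s: "\<bar>s\<bar> = 1" and "0 \<le> t"
    and X: "\<And>i. 1 \<le> i \<Longrightarrow> X i \<in> H"
    and indep: "\<And>i. 1 \<le> i \<Longrightarrow> independent_of H E {1..i} X (X (i + 1))"
    and a: "\<And>i. 1 \<le> i \<Longrightarrow> E (\<lambda>\<omega>. s * X i \<omega>) = a i"
    and K: "\<And>i. 1 \<le> i \<Longrightarrow> E (\<lambda>\<omega>. (X i \<omega>)\<^sup>2) \<le> K"
  shows "E (\<lambda>\<omega>. pos_huber (centred_sum t a s k (\<lambda>i. X i \<omega>))) \<le> k * (t\<^sup>2 * (K + (K + 1)\<^sup>2))"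
proof (induction k)
  case 0
  then show ?case
    by (simp add: centred_sum_def const)
next
  case (Suc k)
  define T where "T = (\<lambda>\<omega>. centred_sum t a s k (\<lambda>i. X i \<omega>))"
  define Y where "Y = (\<lambda>\<omega>. s * X (k + 1) \<omega> - a (k + 1))"
  \<comment> \<open>Hence \<open>s * X i\<close> and \<open>X i\<close> have the same square, and
    \<open>K\<close> serves both signs.\<close>
  have s2: "s\<^sup>2 = 1"
    using s by (metis power2_abs power_one)
  have sq: "(\<lambda>\<omega>. (X (k + 1) \<omega>)\<^sup>2) \<in> H"
    using rich unfolding rich_for_def by (metis (no_types, lifting) ext le_add2 power2_abs)
  have Y2: "(\<lambda>\<omega>. (Y \<omega>)\<^sup>2) \<in> H" "E (\<lambda>\<omega>. (Y \<omega>)\<^sup>2) \<le> 2 * K + 2 * (K + 1)\<^sup>2"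
    using E_centred_square_le[of "\<lambda>\<omega>. s * X (k + 1) \<omega>" K] sq K[of "k + 1"] X[of "k + 1"]
      a[of "k + 1"] scale_mem[of "X (k + 1)" s]
    by (auto simp: Y_def power_mult_distrib s2)
  have mem: "(\<lambda>\<omega>. pos_huber (T \<omega>)) \<in> H" "(\<lambda>\<omega>. unit_clamp (T \<omega>) * Y \<omega>) \<in> H"
    unfolding T_def Y_def
    by (rule pos_huber_centred_sum_mem[OF rich s] clamp_centred_sum_times_mem[OF rich s])+
  have E0: "E (\<lambda>\<omega>. unit_clamp (T \<omega>) * Y \<omega>) = 0"
    unfolding T_def Y_def by (rule E_clamp_centred_sum_times[OF rich s]) (use X indep[of k] a in simp_all)
  have "E (\<lambda>\<omega>. pos_huber (centred_sum t a s (Suc k) (\<lambda>i. X i \<omega>))) \<le>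
      E (\<lambda>\<omega>. pos_huber (T \<omega>) + (t * (unit_clamp (T \<omega>) * Y \<omega>) + t\<^sup>2 / 2 * (Y \<omega>)\<^sup>2))"
  proof (rule monotone)
    fix \<omega>
    have "centred_sum t a s (Suc k) (\<lambda>i. X i \<omega>) = T \<omega> + t * Y \<omega>"
      by (simp add: centred_sum_def T_def Y_def algebra_simps)
    then show "pos_huber (centred_sum t a s (Suc k) (\<lambda>i. X i \<omega>)) \<le>
        pos_huber (T \<omega>) + (t * (unit_clamp (T \<omega>) * Y \<omega>) + t\<^sup>2 / 2 * (Y \<omega>)\<^sup>2)"
      using pos_huber_add_le[of "T \<omega>" "t * Y \<omega>"] by (simp add: power_mult_distrib algebra_simps)
  qed (intro add_mem scale_mem mem Y2 pos_huber_centred_sum_mem[OF rich s])+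
  also have "\<dots> \<le> E (\<lambda>\<omega>. pos_huber (T \<omega>)) +
      E (\<lambda>\<omega>. t * (unit_clamp (T \<omega>) * Y \<omega>) + t\<^sup>2 / 2 * (Y \<omega>)\<^sup>2)"
    by (intro E_add_le add_mem scale_mem mem Y2)
  also have "\<dots> \<le> E (\<lambda>\<omega>. pos_huber (T \<omega>)) +
      (E (\<lambda>\<omega>. t * (unit_clamp (T \<omega>) * Y \<omega>)) + E (\<lambda>\<omega>. t\<^sup>2 / 2 * (Y \<omega>)\<^sup>2))"
    by (intro add_left_mono E_add_le scale_mem mem Y2)
  \<comment> \<open>Here \<open>t \<ge> 0\<close> allows \<open>t\<close> to leave the first-order
    term, which then vanishes by \<open>E0\<close>.\<close>
  also have "\<dots> = E (\<lambda>\<omega>. pos_huber (T \<omega>)) + t\<^sup>2 / 2 * E (\<lambda>\<omega>. (Y \<omega>)\<^sup>2)"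
    using pos_homogeneous[OF mem(2) \<open>0 \<le> t\<close>] pos_homogeneous[OF Y2(1), of "t\<^sup>2 / 2"] E0 by simp
  also have "\<dots> \<le> k * (t\<^sup>2 * (K + (K + 1)\<^sup>2)) + t\<^sup>2 / 2 * (2 * K + 2 * (K + 1)\<^sup>2)"
    using Suc.IH Y2(2) unfolding T_def by (intro add_mono mult_left_mono) auto
  also have "\<dots> = Suc k * (t\<^sup>2 * (K + (K + 1)\<^sup>2))"
    by (simp add: algebra_simps)
  finally show ?case .
qed

end

section \<open>The weak law: from the Huber bound to the lower capacity\<close>

theorem theorem3p3:
  fixes H :: "('a \<Rightarrow> real) set" and E :: "('a \<Rightarrow> real) \<Rightarrow> real"
    and F :: "'a set set" and X :: "nat \<Rightarrow> 'a \<Rightarrow> real"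
    and \<mu>lo \<mu>hi :: "nat \<Rightarrow> real" and \<mu>inf \<mu>sup \<epsilon> :: real
  assumes "sublinear_expectation_space H E"
    and "sigma_algebra UNIV F"
    and "upper_continuous_capacity F (upper_capacity E)"
    and "\<And>i. i \<ge> 1 \<Longrightarrow> X i \<in> H"
    and "\<And>i. i \<ge> 1 \<Longrightarrow> X i \<in> borel_measurable (sigma UNIV F)"
    and "rich_for H F X"
    and "\<And>i. i \<ge> 1 \<Longrightarrow> independent_of H E {1..i} X (X (i + 1))"
    and "\<And>i. i \<ge> 1 \<Longrightarrow> E (X i) = \<mu>hi i"
    and "\<And>i. i \<ge> 1 \<Longrightarrow> conjugate_expectation E (X i) = \<mu>lo i"
    and "\<And>i. i \<ge> 1 \<Longrightarrow> \<mu>lo i \<le> \<mu>hi i"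
    and "(\<lambda>n. (1 / real n) * (\<Sum>i=1..n. \<bar>\<mu>lo i - \<mu>inf\<bar>)) \<longlonglongrightarrow> 0"
    and "(\<lambda>n. (1 / real n) * (\<Sum>i=1..n. \<bar>\<mu>hi i - \<mu>sup\<bar>)) \<longlonglongrightarrow> 0"
    and "bdd_above ((\<lambda>i. E (\<lambda>\<omega>. \<bar>X i \<omega>\<bar>\<^sup>2)) ` {1..})"
    and "\<epsilon> > 0"
  shows "(\<lambda>n. lower_capacity E
            {\<omega>. (1 / real n) * (\<Sum>i=1..n. X i \<omega>) \<in> {\<mu>inf - \<epsilon><..<\<mu>sup + \<epsilon>}}) \<longlonglongrightarrow> 1"
proof -
  interpret sublinear_expectation_space H E
    by fact
  define B where "B = (\<lambda>n. {\<omega>. (1 / real n) * (\<Sum>i=1..n. X i \<omega>) \<in> {\<mu>inf - \<epsilon><..<\<mu>sup + \<epsilon>}})"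
  obtain K where K: "\<And>i. 1 \<le> i \<Longrightarrow> E (\<lambda>\<omega>. (X i \<omega>)\<^sup>2) \<le> K"
    using assms(13) by (auto simp: bdd_above_def)
  define D where "D = K + (K + 1)\<^sup>2"
  \<comment> \<open>Half of \<open>\<epsilon>\<close> absorbs the error of the averaged means; the
    other half is the deviation left for Markov's inequality.\<close>
  define \<delta> where "\<delta> = pos_huber (\<epsilon> / 2)"
  have "\<delta> > 0"
    using assms(14) by (simp add: \<delta>_def pos_huber_pos)
  define hi where "hi = (\<lambda>n \<omega>. pos_huber (centred_sum (1 / n) \<mu>hi 1 n (\<lambda>i. X i \<omega>)))"
  \<comment> \<open>The lower tail of \<open>X\<close> is the upper tail of \<open>- X\<close>,
    whose upper expectations are \<open>- \<mu>lo i\<close>.\<close>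
  define lo where "lo = (\<lambda>n \<omega>. pos_huber (centred_sum (1 / n) (\<lambda>i. - \<mu>lo i) (-1) n (\<lambda>i. X i \<omega>)))"
  have mem: "hi n \<in> H" "lo n \<in> H" for n
    unfolding hi_def lo_def by (intro pos_huber_centred_sum_mem[OF assms(6)]; simp)+
  \<comment> \<open>This covers \<open>n = 0\<close> too, since division by 0 yields 0.\<close>
  have scaled: "real n * ((1 / real n)\<^sup>2 * c) = c / n" for n c
    by (simp add: power2_eq_square)
  have E_hi: "E (hi n) \<le> D / n" for n
    using E_pos_huber_centred_sum_le[OF assms(6), of 1 "1 / n" \<mu>hi K n] assms(4,7,8) K
    unfolding hi_def scaled D_def by simp
  have E_lo: "E (lo n) \<le> D / n" for n
    using E_pos_huber_centred_sum_le[OF assms(6), of "-1" "1 / n" "\<lambda>i. - \<mu>lo i" K n] assms(4,7,9) K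
    unfolding lo_def scaled D_def conjugate_expectation_def by (simp add: minus_equation_iff)
  have ind_mem: "indicator (B n) \<in> H" for n
  proof -
    interpret sigma_algebra UNIV F
      by fact
    have "(\<lambda>\<omega>. (1 / real n) * (\<Sum>i=1..n. X i \<omega>)) \<in> borel_measurable (sigma UNIV F)"
      using assms(5) by (intro borel_measurable_times borel_measurable_sum) auto
    then have "(\<lambda>\<omega>. (1 / real n) * (\<Sum>i=1..n. X i \<omega>)) -` {\<mu>inf - \<epsilon><..<\<mu>sup + \<epsilon>}
        \<inter> space (sigma UNIV F) \<in> sets (sigma UNIV F)"
      by (rule measurable_sets) simp
    then have "B n \<in> F"
      by (simp add: B_def vimage_def sets_measure_of_eq space_measure_of_conv)
    then show ?thesis
      using assms(6) by (simp add: rich_for_def)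
  qed
  \<comment> \<open>Constants pass through \<open>E\<close> exactly, so the lower capacity of
    \<open>B n\<close> is 1 minus the upper capacity of its complement.\<close>
  have lower: "lower_capacity E (B n) = 1 - E (\<lambda>\<omega>. 1 - indicator (B n) \<omega>)" for n
    using E_add_const[OF uminus_mem[OF ind_mem[of n]], of 1]
    by (simp add: lower_capacity_def conjugate_expectation_def)
  have compl_mem: "(\<lambda>\<omega>. 1 - indicator (B n) \<omega>) \<in> H" for n
    by (intro diff_mem const_mem ind_mem)
  \<comment> \<open>The triangle inequality turns Cesaro convergence of the absolute deviations into
    closeness of the averaged means to their limit.\<close>
  have small: "\<forall>\<^sub>F n in sequentially. \<bar>(\<Sum>i=1..n. m i) / n - c\<bar> < \<epsilon> / 2"
    if lim: "(\<lambda>n. (1 / real n) * (\<Sum>i=1..n. \<bar>m i - c\<bar>)) \<longlonglongrightarrow> 0" for m c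
  proof -
    have "\<forall>\<^sub>F n in sequentially. (1 / real n) * (\<Sum>i=1..n. \<bar>m i - c\<bar>) < \<epsilon> / 2"
      by (rule order_tendstoD(2)[OF lim]) (simp add: assms(14))
    then show ?thesis
      using eventually_gt_at_top[of 0]
    proof eventually_elim
      case (elim n)
      have "(\<Sum>i=1..n. m i) / n - c = (1 / n) * (\<Sum>i=1..n. m i - c)"
        using elim by (simp add: sum_subtractf field_simps)
      also have "\<bar>\<dots>\<bar> \<le> (1 / n) * (\<Sum>i=1..n. \<bar>m i - c\<bar>)"
        unfolding abs_mult by (intro mult_mono sum_abs) auto
      finally show ?case
        using elim by linarith
    qed
  qed
  have upper: "\<forall>\<^sub>F n in sequentially. E (\<lambda>\<omega>. 1 - indicator (B n) \<omega>) \<le> 2 * D / \<delta> / n"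
    using small[OF assms(12)] small[OF assms(11)]
  proof eventually_elim
    case (elim n)
    \<comment> \<open>Markov's inequality for both tails at once: off \<open>B n\<close> one centred
      sum is at least \<open>\<epsilon> / 2\<close>, so by monotonicity \<open>hi\<close> or
      \<open>lo\<close> reaches \<open>\<delta>\<close>.\<close>
    have "E (\<lambda>\<omega>. 1 - indicator (B n) \<omega>) \<le> E (\<lambda>\<omega>. (1 / \<delta>) * (hi n \<omega> + lo n \<omega>))"
    proof (rule monotone)
      fix \<omega>
      have nonneg: "0 \<le> hi n \<omega>" "0 \<le> lo n \<omega>"
        by (simp_all add: hi_def lo_def pos_huber_nonneg)
      show "1 - indicator (B n) \<omega> \<le> (1 / \<delta>) * (hi n \<omega> + lo n \<omega>)"
      proof (cases "\<omega> \<in> B n")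
        case True
        then show ?thesis
          using nonneg \<open>\<delta> > 0\<close> by simp
      next
        case False
        define S where "S = (\<Sum>i=1..n. X i \<omega>) / n"
        have "\<epsilon> / 2 \<le> centred_sum (1 / n) \<mu>hi 1 n (\<lambda>i. X i \<omega>) \<or>
            \<epsilon> / 2 \<le> centred_sum (1 / n) (\<lambda>i. - \<mu>lo i) (-1) n (\<lambda>i. X i \<omega>)"
        proof -
          have "S \<le> \<mu>inf - \<epsilon> \<or> \<mu>sup + \<epsilon> \<le> S"
            using False by (auto simp: B_def S_def)
          moreover have "centred_sum (1 / n) \<mu>hi 1 n (\<lambda>i. X i \<omega>) = S - (\<Sum>i=1..n. \<mu>hi i) / n"
            by (simp add: centred_sum_def S_def sum_subtractf diff_divide_distrib)
          moreover have "centred_sum (1 / n) (\<lambda>i. - \<mu>lo i) (-1) n (\<lambda>i. X i \<omega>) =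
              (\<Sum>i=1..n. \<mu>lo i) / n - S"
            by (simp add: centred_sum_def S_def sum_subtractf diff_divide_distrib)
          ultimately show ?thesis
            using elim by linarith
        qed
        then have "\<delta> \<le> hi n \<omega> \<or> \<delta> \<le> lo n \<omega>"
          unfolding \<delta>_def hi_def lo_def by (auto intro: pos_huber_mono)
        then show ?thesis
          using False nonneg \<open>\<delta> > 0\<close> by (auto simp: field_simps)
      qed
    qed (intro compl_mem scale_mem add_mem mem)+
    also have "\<dots> = (1 / \<delta>) * E (\<lambda>\<omega>. hi n \<omega> + lo n \<omega>)"
      using \<open>\<delta> > 0\<close> by (intro pos_homogeneous add_mem mem) auto
    also have "\<dots> \<le> (1 / \<delta>) * (D / n + D / n)"
      using \<open>\<delta> > 0\<close> E_add_le[OF mem, of n n] E_hi[of n] E_lo[of n] by (intro mult_left_mono) auto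
    also have "\<dots> = 2 * D / \<delta> / n"
      by simp
    finally show ?case .
  qed
  have "0 \<le> E (\<lambda>\<omega>. 1 - indicator (B n) \<omega>)" for n
    using monotone[OF compl_mem const_mem[of 0]] by (simp add: const indicator_def)
  then have "(\<lambda>n. E (\<lambda>\<omega>. 1 - indicator (B n) \<omega>)) \<longlonglongrightarrow> 0"
    using upper lim_const_over_n[of "2 * D / \<delta>"]
    by (intro tendsto_sandwich[OF _ upper tendsto_const]) auto
  then have "(\<lambda>n. lower_capacity E (B n)) \<longlonglongrightarrow> 1 - 0"
    unfolding lower by (intro tendsto_intros)
  then show ?thesis
    by (simp add: B_def)
qed

end
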